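(* Let $\ell, m, r$ be positive integers such that $2\nmid \ell$, $3\nmid \ell m$, $\ell>r$ and $3\mid r$. Put $A=r\ell m^2-1$, $B=(\ell-r)\ell m^2+1$, $C=\ell m$. If $\min\{r\ell m^2-1,(\ell-r)\ell m^2+1\}>30$, then the equation $A^x+B^y=C^z$ in positive integers $x,y,z$ has only the solution $(x,y,z)=(1,1,2)$. *)

theory Defs
  imports Main
begin

end

theory Submission
  imports Defs Complex_Main "HOL-Computational_Algebra.Primes"
begin

text \<open>Congruences modulo \<open>C\<close> and 3 force \<open>x\<close> and \<open>y\<close> to be odd, and comparing \<open>A^x + B^y = C^z\<close> modulo
  \<open>m^4\<close> shows that \<open>m\<close> (hence \<open>C\<close>) is odd as soon as \<open>z \<ge> 3\<close>. Then \<open>A X^2 + B Y^2 = C^z\<close> with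
  \<open>X = \<plusminus>A^a\<close>, \<open>Y = B^b\<close> and \<open>X \<equiv> Y\<close> modulo \<open>C\<close>. Since \<open>A + B = C^2\<close>, a descent gives \<open>z = 2t\<close>
  with \<open>t\<close> odd and \<open>X \<surd>A + i Y \<surd>B = \<plusminus>(\<surd>A + i \<surd>B)^t\<close>. In the binomial expansion of \<open>X\<close> the
  term \<open>t (-B)^((t-1)/2)\<close> has the smallest \<open>p\<close>-adic valuation at every prime \<open>p\<close> dividing \<open>A\<close>
  (here \<open>p \<noteq> 3\<close> matters), so \<open>A^a\<close> divides \<open>t\<close>; likewise \<open>B^b\<close> divides \<open>t\<close>. Hence
  \<open>C^(2t) \<le> C^2 t^2\<close>, which is absurd for \<open>t \<ge> 3\<close>.\<close>

section \<open>Odd powers of a binomial\<close>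

text \<open>For \<open>a = x^2\<close>, \<open>b = y^2\<close> this is the cofactor of
  \<open>x\<close> in the part of \<open>(x + y)^(2k+1)\<close> odd in \<open>x\<close>. Taking
  squares as arguments keeps it integral at \<open>A\<close>, \<open>-B\<close>, where
  \<open>x\<close>, \<open>y\<close> are \<open>sqrt A\<close>, \<open>i sqrt B\<close>.\<close>

definition odd_binom_sum :: "'a::comm_ring_1 \<Rightarrow> 'a \<Rightarrow> nat \<Rightarrow> 'a"
  where "odd_binom_sum a b k = (\<Sum>j\<le>k. of_nat ((2 * k + 1) choose (2 * j + 1)) * a ^ j * b ^ (k - j))"

lemma sum_lessThan_double:
  fixes f :: "nat \<Rightarrow> 'a::comm_monoid_add"
  shows "(\<Sum>i<2 * n. f i) = (\<Sum>j<n. f (2 * j)) + (\<Sum>j<n. f (2 * j + 1))"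
  by (induction n) (simp_all add: ac_simps)

lemma power_odd_eq_odd_binom_sum:
  fixes x y :: "'a::comm_ring_1"
  shows "(x + y) ^ (2 * k + 1) =
    x * odd_binom_sum (x\<^sup>2) (y\<^sup>2) k + y * odd_binom_sum (y\<^sup>2) (x\<^sup>2) k"
proof -
  let ?f = "\<lambda>i. of_nat ((2 * k + 1) choose i) * x ^ i * y ^ (2 * k + 1 - i)"
  have "(x + y) ^ (2 * k + 1) = (\<Sum>i\<le>2 * k + 1. ?f i)"
    by (rule binomial_ring)
  also have "{..2 * k + 1} = {..<2 * (k + 1)}" by auto
  also have "(\<Sum>i<2 * (k + 1). ?f i) = (\<Sum>j<k + 1. ?f (2 * j)) + (\<Sum>j<k + 1. ?f (2 * j + 1))"
    by (rule sum_lessThan_double)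
  also have "{..<k + 1} = {..k}" by auto
  also have "(\<Sum>j\<le>k. ?f (2 * j + 1)) = x * odd_binom_sum (x\<^sup>2) (y\<^sup>2) k"
    unfolding odd_binom_sum_def sum_distrib_left
  proof (rule sum.cong[OF refl])
    fix j assume "j \<in> {..k}"
    then have "2 * k + 1 - (2 * j + 1) = 2 * (k - j)" by auto
    then show "?f (2 * j + 1) = x * (of_nat ((2 * k + 1) choose (2 * j + 1)) * (x\<^sup>2) ^ j * (y\<^sup>2) ^ (k - j))"
      by (simp add: ac_simps flip: power_mult)
  qed
  \<comment> \<open>Reversing the index and binomial symmetry bring these terms, odd in
    \<open>y\<close>, into the same form with \<open>x\<close> and \<open>y\<close>
    exchanged.\<close>
  also have "(\<Sum>j\<le>k. ?f (2 * j)) = (\<Sum>j\<le>k. ?f (2 * (k - j)))"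
    by (rule sum.reindex_bij_witness[of _ "\<lambda>j. k - j" "\<lambda>j. k - j"]) auto
  also have "\<dots> = y * odd_binom_sum (y\<^sup>2) (x\<^sup>2) k"
    unfolding odd_binom_sum_def sum_distrib_left
  proof (rule sum.cong[OF refl])
    fix j assume "j \<in> {..k}"
    then have *: "2 * k + 1 - 2 * (k - j) = 2 * j + 1" "2 * (k - j) = 2 * k + 1 - (2 * j + 1)"
      "2 * j + 1 \<le> 2 * k + 1" by auto
    have "(2 * k + 1) choose (2 * (k - j)) = (2 * k + 1) choose (2 * j + 1)"
      unfolding *(2) by (rule binomial_symmetric[OF *(3), symmetric])
    then show "?f (2 * (k - j)) = y * (of_nat ((2 * k + 1) choose (2 * j + 1)) * (y\<^sup>2) ^ j * (x\<^sup>2) ^ (k - j))"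
      unfolding *(1) by (simp add: ac_simps flip: power_mult)
  qed
  finally show ?thesis by (simp add: add.commute)
qed

section \<open>Valuations of the odd binomial sums\<close>

text \<open>The prime 2 never divides \<open>2j+1\<close>, and for \<open>p \<ge> 5\<close> already
  \<open>5^j > 2j+1\<close>. The prime 3 fails at \<open>j = 1\<close>; hence the later care that 3
  divides neither \<open>A\<close> nor \<open>B\<close>.\<close>

lemma multiplicity_odd_less:
  fixes p :: nat
  assumes p: "prime p" "p \<noteq> 3" and j: "j > 0"
  shows "multiplicity p (2 * j + 1) < j"
proof (rule ccontr)
  assume "\<not> ?thesis"
  then have d: "p ^ j dvd 2 * j + 1" by (intro multiplicity_dvd') auto
  have "p \<noteq> 2"
  proof
    assume "p = 2"
    then have "2 dvd p ^ j" using j by simp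
    then have "2 dvd 2 * j + 1" using d by (rule dvd_trans)
    then show False by simp
  qed
  then have "odd p" using p(1) prime_ge_2_nat[of p] by (intro prime_odd_nat) auto
  then have "p \<noteq> 4" by auto
  then have "p \<ge> 5" using p \<open>p \<noteq> 2\<close> prime_ge_2_nat[of p] by linarith
  then have "5 ^ j \<le> p ^ j" by (rule power_mono) simp
  also have "\<dots> \<le> 2 * j + 1" using d by (rule dvd_imp_le) simp
  finally have "(5::nat) ^ j \<le> 2 * j + 1" .
  moreover have "(5::nat) ^ j > 2 * j + 1" using j
    by (induction j rule: nat_induct_non_zero) auto
  ultimately show False by simp
qed

lemma multiplicity_int_of_nat:
  fixes p n :: nat
  assumes "prime p" "n > 0"
  shows "multiplicity (int p) (int n) = multiplicity p n"
proof (rule multiplicity_eqI)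
  show "int p ^ multiplicity p n dvd int n"
    unfolding of_nat_power[symmetric] int_dvd_int_iff by (rule multiplicity_dvd)
  show "\<not> int p ^ Suc (multiplicity p n) dvd int n"
  proof
    assume "int p ^ Suc (multiplicity p n) dvd int n"
    then have "p ^ Suc (multiplicity p n) dvd n"
      unfolding of_nat_power[symmetric] int_dvd_int_iff .
    then have "Suc (multiplicity p n) \<le> multiplicity p n"
      using assms by (intro multiplicity_geI) auto
    then show False by simp
  qed
qed

text \<open>By the absorption identity \<open>id\<close> the binomial coefficient loses at most the
  valuation of \<open>2j+1\<close>, which is less than \<open>j\<close>, while \<open>a^j\<close>
  gains at least \<open>j\<close>.\<close>

lemma power_dvd_odd_binomial_term:
  fixes p :: nat and a :: int
  assumes p: "prime p" "p \<noteq> 3" "int p dvd a" and j: "j > 0" "j \<le> k"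
  shows "int p ^ Suc (multiplicity p (2 * k + 1)) dvd int ((2 * k + 1) choose (2 * j + 1)) * a ^ j"
proof -
  let ?C = "(2 * k + 1) choose (2 * j + 1)"
  have C: "?C > 0" using j by (simp add: zero_less_binomial)
  have id: "(2 * j + 1) * ?C = (2 * k + 1) * ((2 * k) choose (2 * j))"
    using Suc_times_binomial_eq[of "2 * k" "2 * j"] by (simp add: mult.commute)
  have "p ^ multiplicity p (2 * k + 1) dvd (2 * j + 1) * ?C"
    unfolding id by (intro dvd_mult2 multiplicity_dvd)
  then have "multiplicity p (2 * k + 1) \<le> multiplicity p ((2 * j + 1) * ?C)"
    using C p(1) by (intro multiplicity_geI) auto
  also have "\<dots> = multiplicity p (2 * j + 1) + multiplicity p ?C"
    using C p(1) by (subst prime_elem_multiplicity_mult_distrib) auto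
  finally have "Suc (multiplicity p (2 * k + 1)) \<le> multiplicity p ?C + j"
    using multiplicity_odd_less[OF p(1,2) j(1)] by linarith
  then have "int p ^ Suc (multiplicity p (2 * k + 1)) dvd int p ^ (multiplicity p ?C + j)"
    by (rule le_imp_power_dvd)
  also have "\<dots> = int (p ^ multiplicity p ?C) * int p ^ j" by (simp add: power_add)
  also have "\<dots> dvd int ?C * a ^ j"
    using p(3) by (intro mult_dvd_mono dvd_power_same int_dvd_int_iff[THEN iffD2] multiplicity_dvd)
  finally show ?thesis .
qed

text \<open>The term \<open>j = 0\<close> is \<open>(2k+1) * b^k\<close> with \<open>b\<close> prime
  to \<open>p\<close>; all other terms have valuation strictly above that of
  \<open>2k+1\<close>.\<close>

lemma multiplicity_odd_binom_sum:
  fixes p :: nat and a b :: int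
  assumes p: "prime p" "p \<noteq> 3" "int p dvd a" "\<not> int p dvd b"
  shows "multiplicity (int p) (odd_binom_sum a b k) = multiplicity p (2 * k + 1)"
proof (rule multiplicity_eqI)
  let ?e = "multiplicity p (2 * k + 1)"
  let ?f = "\<lambda>j. int ((2 * k + 1) choose (2 * j + 1)) * a ^ j * b ^ (k - j)"
  have "odd_binom_sum a b k = ?f 0 + (\<Sum>j\<in>{..k} - {0}. ?f j)"
    unfolding odd_binom_sum_def by (subst sum.remove[of _ 0]) auto
  also have "?f 0 = int (2 * k + 1) * b ^ k" by simp
  finally have S: "odd_binom_sum a b k = int (2 * k + 1) * b ^ k + (\<Sum>j\<in>{..k} - {0}. ?f j)" .
  have rest: "int p ^ Suc ?e dvd (\<Sum>j\<in>{..k} - {0}. ?f j)"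
    by (intro dvd_sum dvd_mult2 power_dvd_odd_binomial_term p) auto
  have pe: "int p ^ ?e dvd int (2 * k + 1)"
    unfolding of_nat_power[symmetric] int_dvd_int_iff by (rule multiplicity_dvd)
  show "int p ^ ?e dvd odd_binom_sum a b k"
    unfolding S using power_le_dvd[OF rest, of ?e] pe by (intro dvd_add dvd_mult2) simp_all
  show "\<not> int p ^ Suc ?e dvd odd_binom_sum a b k"
  proof
    assume "int p ^ Suc ?e dvd odd_binom_sum a b k"
    then have "int p ^ Suc ?e dvd int (2 * k + 1) * b ^ k"
      unfolding S using rest by (simp only: dvd_add_left_iff)
    moreover have "coprime (int p ^ Suc ?e) (b ^ k)"
      using prime_imp_coprime[of "int p" b] p
      unfolding coprime_power_left_iff coprime_power_right_iff by simp
    ultimately have "int p ^ Suc ?e dvd int (2 * k + 1)"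
      using coprime_dvd_mult_left_iff by blast
    then have "p ^ Suc ?e dvd 2 * k + 1"
      unfolding of_nat_power[symmetric] int_dvd_int_iff .
    then have "Suc ?e \<le> ?e"
      using p(1) by (intro multiplicity_geI) auto
    then show False by simp
  qed
qed

text \<open>Every prime factor of \<open>c\<close> divides \<open>a\<close> but not
  \<open>b\<close>, so there \<open>c^n\<close> and \<open>2k+1\<close> have the same valuation;
  hence \<open>c^n\<close> divides \<open>2k+1\<close>.\<close>

lemma power_eq_odd_binom_sum_imp_le:
  fixes a b c :: int
  assumes eq: "\<bar>odd_binom_sum a b k\<bar> = \<bar>c\<bar> ^ n" and ca: "c dvd a" and c0: "c \<noteq> 0"
    and cop: "coprime a b" and n3: "\<not> 3 dvd c"
  shows "\<bar>c\<bar> ^ n \<le> int (2 * k + 1)"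
proof -
  have "c ^ n dvd int (2 * k + 1)"
  proof (rule multiplicity_le_imp_dvd)
    show "c ^ n \<noteq> 0" using c0 by simp
    fix q :: int assume q: "prime q"
    define p where "p = nat q"
    have qp: "q = int p" "prime p"
      using prime_gt_0_int[OF q] q[unfolded prime_int_nat_transfer[of q]] unfolding p_def by auto
    show "multiplicity q (c ^ n) \<le> multiplicity q (int (2 * k + 1))"
    proof (cases "q dvd c")
      case False
      then have "\<not> q dvd c ^ n" using q prime_dvd_power by blast
      then show ?thesis by (simp add: not_dvd_imp_multiplicity_0)
    next
      case True
      then have qa: "q dvd a" using ca by (rule dvd_trans)
      have "\<not> q dvd b" using cop qa q by (meson coprime_common_divisor not_prime_unit)
      moreover have "p \<noteq> 3" using True n3 qp by auto
      ultimately have m: "multiplicity (int p) (odd_binom_sum a b k) = multiplicity p (2 * k + 1)"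
        using multiplicity_odd_binom_sum[of p a b k] qp qa by simp
      have "\<bar>c ^ n\<bar> = \<bar>odd_binom_sum a b k\<bar>" using eq by (simp add: power_abs)
      then have "c ^ n = odd_binom_sum a b k \<or> c ^ n = - odd_binom_sum a b k" by linarith
      then have "multiplicity q (c ^ n) = multiplicity q (odd_binom_sum a b k)"
        by (auto simp: multiplicity_def)
      also have "\<dots> = multiplicity q (int (2 * k + 1))"
        using m qp multiplicity_int_of_nat[of p "2 * k + 1"] by simp
      finally show ?thesis by simp
    qed
  qed
  then have "\<bar>c ^ n\<bar> \<le> int (2 * k + 1)" using zdvd_imp_le[of "\<bar>c ^ n\<bar>"] by simp
  then show ?thesis by (simp add: power_abs)
qed

section \<open>Congruences for powers, and odd powers of \<open>sqrt A + i sqrt B\<close>\<close>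

lemma square_dvd_power_minus_linear:
  fixes u :: "'a::comm_ring_1"
  shows "u\<^sup>2 dvd (1 + u) ^ n - (1 + of_nat n * u)"
proof (induction n)
  case (Suc n)
  have "(1 + u) ^ Suc n - (1 + of_nat (Suc n) * u)
      = (1 + u) * ((1 + u) ^ n - (1 + of_nat n * u)) + u\<^sup>2 * of_nat n"
    by (simp add: algebra_simps power2_eq_square)
  then show ?case using Suc by (simp only: dvd_add dvd_mult dvd_triv_left)
qed simp

lemma dvd_power_minus_one:
  fixes u :: "'a::comm_ring_1"
  assumes "d dvd u - 1"
  shows "d dvd u ^ n - 1"
proof (induction n)
  case (Suc n)
  have "u ^ Suc n - 1 = u * (u ^ n - 1) + (u - 1)" by (simp add: algebra_simps)
  then show ?case using Suc assms by (simp only: dvd_add dvd_mult)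
qed simp

lemma of_int_odd_binom_sum:
  "of_int (odd_binom_sum a b k) = odd_binom_sum (of_int a) (of_int b) k"
  by (simp add: odd_binom_sum_def)

text \<open>Odd powers keep the shape \<open>P sqrt A + i Q sqrt B\<close> with integers
  \<open>P\<close>, \<open>Q\<close>, which can then be compared with \<open>X\<close>,
  \<open>Y\<close>.\<close>

lemma Complex_sqrt_power_odd:
  fixes A B :: int
  assumes "A \<ge> 0" "B \<ge> 0"
  shows "Complex (sqrt A) (sqrt B) ^ (2 * k + 1) =
    Complex (sqrt A * odd_binom_sum A (- B) k) (sqrt B * odd_binom_sum (- B) A k)"
proof -
  define x y where "x = complex_of_real (sqrt A)" and "y = \<i> * complex_of_real (sqrt B)"
  have x2: "x\<^sup>2 = of_int A"
    using assms unfolding x_def by (simp flip: of_real_power)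
  have y2: "y\<^sup>2 = of_int (- B)"
    using assms unfolding y_def by (simp add: power_mult_distrib flip: of_real_power)
  have "Complex (sqrt A) (sqrt B) = x + y"
    by (simp add: x_def y_def complex_eq_iff)
  then have "Complex (sqrt A) (sqrt B) ^ (2 * k + 1) =
      x * of_int (odd_binom_sum A (- B) k) + y * of_int (odd_binom_sum (- B) A k)"
    by (simp only: power_odd_eq_odd_binom_sum x2 y2 of_int_odd_binom_sum)
  then show ?thesis
    by (simp add: x_def y_def complex_eq_iff)
qed

section \<open>Descent for \<open>A X^2 + B Y^2 = C^z\<close>\<close>

lemma coprime_of_dvd_diff:
  fixes C X Y :: int
  assumes "coprime X C" and "C dvd X - Y"
  shows "coprime Y C"
proof (rule coprimeI)
  fix d assume d: "d dvd Y" "d dvd C"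
  then have "d dvd (X - Y) + Y" using assms(2) by (meson dvd_add dvd_trans)
  then have "d dvd X" by simp
  then show "is_unit d" by (rule coprime_common_divisor[OF assms(1) _ d(2)])
qed

text \<open>A common divisor of \<open>R\<close> and \<open>C\<close> divides \<open>P\<close>,
  hence \<open>P - R\<close>; so \<open>R\<close> is coprime to \<open>C\<close> and all of
  \<open>C^n\<close> falls on \<open>P\<close>.\<close>

lemma power_dvd_left_factor:
  fixes C P R :: int
  assumes "C ^ n dvd P * R" and CP: "C dvd P" and cop: "coprime (P - R) C"
  shows "C ^ n dvd P"
proof -
  have "coprime R C"
  proof (rule coprimeI)
    fix d assume d: "d dvd R" "d dvd C"
    then have "d dvd P - R" using CP by (meson dvd_diff dvd_trans)
    then show "is_unit d" by (rule coprime_common_divisor[OF cop _ d(2)])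
  qed
  then have "coprime (C ^ n) R" by (simp add: coprime_commute)
  then show ?thesis using assms(1) by (simp add: coprime_dvd_mult_left_iff)
qed

lemma power_dvd_of_weighted_squares:
  fixes A B C P Q :: int
  assumes eq: "A * P\<^sup>2 + B * Q\<^sup>2 = C ^ N" and N: "2 * n \<le> N" and P: "C ^ n dvd P" and cop: "coprime B C"
  shows "C ^ n dvd Q"
proof -
  have "(C ^ n)\<^sup>2 dvd C ^ N" using N by (simp add: le_imp_power_dvd mult.commute flip: power_mult)
  moreover have "(C ^ n)\<^sup>2 dvd A * P\<^sup>2" using P by (simp add: dvd_power_same)
  ultimately have "(C ^ n)\<^sup>2 dvd B * Q\<^sup>2" using eq by (metis dvd_add_right_iff)
  moreover have "coprime ((C ^ n)\<^sup>2) B" using cop by (simp add: coprime_commute)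
  ultimately have "(C ^ n)\<^sup>2 dvd Q\<^sup>2" by (simp add: coprime_dvd_mult_right_iff)
  then show ?thesis by simp
qed

text \<open>In terms of \<open>\<epsilon> = \<surd>A + i \<surd>B\<close> and \<open>\<eta> = X \<surd>A + i Y \<surd>B\<close>, of norms \<open>C\<^sup>2\<close> and \<open>C\<^sup>z\<close>, the hypothesis
  \<open>C dvd X - Y\<close> places \<open>\<eta>\<close> in the class of \<open>\<epsilon>\<close>, so that \<open>\<eta>\<close> can be divided by \<open>\<epsilon>\<^sup>2\<close>.\<close>

lemma descent_step:
  fixes A B C X Y :: int
  assumes sum: "A + B = C\<^sup>2" and C: "odd C" "C > 2"
    and cop: "coprime B C" "coprime X C" "C dvd X - Y"
    and eq: "A * X\<^sup>2 + B * Y\<^sup>2 = C ^ z" and z: "z \<ge> 4"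
  obtains X1 Y1 where "A * X1\<^sup>2 + B * Y1\<^sup>2 = C ^ (z - 4)"
    and "X = X1 * (A - B) - 2 * B * Y1" and "Y = Y1 * (A - B) + 2 * A * X1"
proof -
  \<comment> \<open>\<open>P\<close>, \<open>Q\<close> are the coefficients of \<open>\<eta>\<close>
    times the squared conjugate of \<open>\<epsilon>\<close>; \<open>R\<close> is the
    \<open>sqrt A\<close> coefficient of \<open>\<epsilon>^2 \<eta>\<close>. As
    \<open>|\<epsilon>|^4 = C^4\<close>, dividing \<open>\<eta>\<close> by
    \<open>\<epsilon>^2\<close> means dividing \<open>P\<close>, \<open>Q\<close> by
    \<open>C^4\<close>.\<close>
  define P Q R where "P = X * (A - B) + 2 * B * Y" and "Q = Y * (A - B) - 2 * A * X"
    and "R = X * (A - B) - 2 * B * Y"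
  have copY: "coprime Y C" using cop(2,3) by (rule coprime_of_dvd_diff)
  \<comment> \<open>Here \<open>C dvd X - Y\<close> decides that \<open>P\<close>, and not
    \<open>R\<close>, absorbs the powers of \<open>C\<close>.\<close>
  have "P = X * C\<^sup>2 - 2 * B * (X - Y)" unfolding P_def sum[symmetric] by algebra
  then have CP: "C dvd P" using cop(3) by (simp add: power2_eq_square)
  have BY: "B * Y\<^sup>2 = C ^ z - A * X\<^sup>2" using eq by simp
  have "P * R = X\<^sup>2 * (A - B)\<^sup>2 - 4 * B * (B * Y\<^sup>2)" unfolding P_def R_def by algebra
  also have "\<dots> = X\<^sup>2 * (A + B)\<^sup>2 - 4 * B * C ^ z" unfolding BY by algebra
  also have "\<dots> = C ^ 4 * X\<^sup>2 - 4 * B * C ^ z" unfolding sum by simp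
  also have "C ^ 4 dvd \<dots>" using z by (simp add: le_imp_power_dvd)
  finally have "C ^ 4 dvd P * R" .
  moreover have "coprime (P - R) C"
  proof -
    have "P - R = 2 ^ 2 * B * Y" unfolding P_def R_def by algebra
    moreover have "coprime (2 ^ 2) C" using C(1) unfolding coprime_power_left_iff by simp
    ultimately show ?thesis using cop(1) copY by (simp only: coprime_mult_left_iff)
  qed
  ultimately have P: "C ^ 4 dvd P" by (rule power_dvd_left_factor[OF _ CP])
  have "A * P\<^sup>2 + B * Q\<^sup>2 = (A + B)\<^sup>2 * (A * X\<^sup>2 + B * Y\<^sup>2)" unfolding P_def Q_def by algebra
  also have "\<dots> = C ^ (z + 4)" unfolding eq sum by (simp add: power_add)
  finally have PQ: "A * P\<^sup>2 + B * Q\<^sup>2 = C ^ (z + 4)" .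
  then have Q: "C ^ 4 dvd Q"
    using z P cop(1) by (intro power_dvd_of_weighted_squares[of A P B Q C "z + 4"]) auto
  obtain X1 where X1: "P = C ^ 4 * X1" using P by (rule dvdE)
  obtain Y1 where Y1: "Q = C ^ 4 * Y1" using Q by (rule dvdE)
  have C4: "C ^ 4 \<noteq> 0" using C by simp
  have AB: "(A + B)\<^sup>2 = C ^ 4" unfolding sum by simp
  have "C ^ 8 * (A * X1\<^sup>2 + B * Y1\<^sup>2) = C ^ (z + 4)"
    unfolding PQ[symmetric] X1 Y1 by (simp add: power_mult_distrib algebra_simps)
  also have "z + 4 = 8 + (z - 4)" using z by simp
  finally have n1: "A * X1\<^sup>2 + B * Y1\<^sup>2 = C ^ (z - 4)" using C by (simp add: power_add)
  have "C ^ 4 * X = P * (A - B) - 2 * B * Q"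
    unfolding P_def Q_def AB[symmetric] by algebra
  also have "\<dots> = C ^ 4 * (X1 * (A - B) - 2 * B * Y1)" unfolding X1 Y1 by (simp add: algebra_simps)
  finally have X: "X = X1 * (A - B) - 2 * B * Y1" using C4 by simp
  have "C ^ 4 * Y = Q * (A - B) + 2 * A * P"
    unfolding P_def Q_def AB[symmetric] by algebra
  also have "\<dots> = C ^ 4 * (Y1 * (A - B) + 2 * A * X1)" unfolding X1 Y1 by (simp add: algebra_simps)
  finally have Y: "Y = Y1 * (A - B) + 2 * A * X1" using C4 by simp
  show ?thesis using that n1 X Y by blast
qed

text \<open>Lets the descent be iterated. Modulo \<open>C\<close> the old first coordinate is
  \<open>-2B(X + Y)\<close>, so \<open>X + Y\<close> is coprime to \<open>C\<close>; since
  \<open>B\<close> is \<open>-A\<close> modulo \<open>C\<close>, \<open>C\<close> divides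
  \<open>A(X - Y)(X + Y)\<close>, hence \<open>X - Y\<close>.\<close>

lemma descent_preserves_class:
  fixes A B C X Y :: int
  assumes sum: "A + B = C\<^sup>2" and cop: "coprime A C" "coprime (X * (A - B) - 2 * B * Y) C"
    and d: "C dvd A * X\<^sup>2 + B * Y\<^sup>2"
  shows "coprime X C" "C dvd X - Y"
proof -
  have cp: "coprime (X + Y) C"
  proof (rule coprimeI)
    fix d assume d: "d dvd X + Y" "d dvd C"
    have "X * (A - B) - 2 * B * Y = X * C\<^sup>2 - 2 * B * (X + Y)" unfolding sum[symmetric] by algebra
    also have "d dvd \<dots>" using d by (intro dvd_diff dvd_mult) (auto simp: power2_eq_square)
    finally show "is_unit d" by (rule coprime_common_divisor[OF cop(2) _ d(2)])
  qed
  have "A * ((X - Y) * (X + Y)) = (A * X\<^sup>2 + B * Y\<^sup>2) - C\<^sup>2 * Y\<^sup>2" unfolding sum[symmetric] by algebra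
  also have "C dvd \<dots>" using d by (intro dvd_diff) (auto simp: power2_eq_square)
  finally have "C dvd (X - Y) * (X + Y)"
    using cop(1) by (simp add: coprime_dvd_mult_right_iff coprime_commute)
  then show *: "C dvd X - Y" using cp by (simp add: coprime_dvd_mult_left_iff coprime_commute)
  show "coprime X C"
  proof (rule coprimeI)
    fix d assume d: "d dvd X" "d dvd C"
    then have "d dvd X - (X - Y)" using * by (meson dvd_diff dvd_trans)
    then have "d dvd X * (A - B) - 2 * B * Y" using d(1) by simp
    then show "is_unit d" by (rule coprime_common_divisor[OF cop(2) _ d(2)])
  qed
qed

text \<open>With exponent 3, \<open>\<eta>\<close> is multiplied by one conjugate of
  \<open>\<epsilon>\<close> only, giving \<open>P^2 + A B (X - Y)^2 = C^5\<close>. Then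
  \<open>C^2\<close> divides \<open>X - Y\<close>: either \<open>X = Y\<close> and
  \<open>X^2 = C\<close>, against coprimality, or \<open>A B \<le> C\<close>, against
  \<open>A + B = C^2\<close>.\<close>

lemma no_cube_representation:
  fixes A B C X Y :: int
  assumes sum: "A + B = C\<^sup>2" and C: "odd C" "C > 2" and pos: "A > 0" "B > 0"
    and cop: "coprime A C" "coprime B C" "coprime X C" "C dvd X - Y"
  shows "A * X\<^sup>2 + B * Y\<^sup>2 \<noteq> C ^ 3"
proof
  assume eq: "A * X\<^sup>2 + B * Y\<^sup>2 = C ^ 3"
  define P R where "P = X * A + Y * B" and "R = X * A - Y * B"
  have copY: "coprime Y C" using cop(3,4) by (rule coprime_of_dvd_diff)
  have "P = X * C\<^sup>2 - B * (X - Y)" unfolding P_def sum[symmetric] by algebra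
  then have CP: "C dvd P" using cop(4) by (simp add: power2_eq_square)
  have "P * R = A * (A * X\<^sup>2 + B * Y\<^sup>2) - (A + B) * B * Y\<^sup>2" unfolding P_def R_def by algebra
  also have "\<dots> = C\<^sup>2 * (A * C - B * Y\<^sup>2)" unfolding eq sum by (simp add: algebra_simps power2_eq_square power3_eq_cube)
  finally have "C\<^sup>2 dvd P * R" by simp
  moreover have "coprime (P - R) C"
  proof -
    have "P - R = 2 * B * Y" unfolding P_def R_def by algebra
    moreover have "coprime 2 C" using C(1) by simp
    ultimately show ?thesis using cop(2) copY by (simp only: coprime_mult_left_iff)
  qed
  ultimately have P: "C\<^sup>2 dvd P" by (rule power_dvd_left_factor[OF _ CP])
  have "1 * P\<^sup>2 + A * B * (X - Y)\<^sup>2 = (A + B) * (A * X\<^sup>2 + B * Y\<^sup>2)" unfolding P_def by algebra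
  also have "\<dots> = C ^ 5" unfolding eq sum by (simp flip: power_add)
  finally have n: "1 * P\<^sup>2 + A * B * (X - Y)\<^sup>2 = C ^ 5" .
  have "coprime (A * B) C" using cop(1,2) by simp
  from power_dvd_of_weighted_squares[OF n _ P this] have d: "C\<^sup>2 dvd X - Y" by simp
  show False
  proof (cases "X = Y")
    case True
    then have "C\<^sup>2 * X\<^sup>2 = C\<^sup>2 * C" using eq sum by (simp add: power2_eq_square power3_eq_cube flip: distrib_right)
    then have "X\<^sup>2 = C" using C by simp
    then have "C dvd X\<^sup>2" by simp
    moreover have "coprime (X\<^sup>2) C" using cop(3) by simp
    ultimately have "is_unit C" by (meson coprime_common_divisor dvd_refl)
    then show False using C by simp
  next
    case False
    have "\<bar>C\<^sup>2\<bar> \<le> \<bar>X - Y\<bar>" using d False by (intro dvd_imp_le_int) auto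
    then have "(C\<^sup>2)\<^sup>2 \<le> (X - Y)\<^sup>2" by (simp only: abs_le_square_iff)
    then have "(A * B) * (C\<^sup>2)\<^sup>2 \<le> (A * B) * (X - Y)\<^sup>2" using pos by (intro mult_left_mono) auto
    also have "\<dots> \<le> C ^ 5" using n zero_le_power2[of P] by linarith
    also have "C ^ 5 = C * (C\<^sup>2)\<^sup>2" by (simp flip: power_mult power_Suc)
    finally have "A * B \<le> C" using C by simp
    moreover have "A + B \<le> A * B + 1"
      using mult_nonneg_nonneg[of "A - 1" "B - 1"] pos by (simp add: algebra_simps)
    moreover have "C\<^sup>2 \<ge> 3 * C" using C by (simp add: power2_eq_square)
    ultimately show False using sum C by linarith
  qed
qed

lemma weighted_squares_sum_bound:
  fixes A B X Y :: int
  assumes "A > 0" "B > 0" "X \<noteq> 0" "Y \<noteq> 0"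
  shows "A + B \<le> A * X\<^sup>2 + B * Y\<^sup>2"
    and "A * X\<^sup>2 + B * Y\<^sup>2 = A + B \<Longrightarrow> X\<^sup>2 = 1 \<and> Y\<^sup>2 = 1"
proof -
  have X: "X\<^sup>2 \<ge> 1" "Y\<^sup>2 \<ge> 1" using assms(3,4) by (smt (verit) zero_less_power2)+
  have *: "A * 1 \<le> A * X\<^sup>2" "B * 1 \<le> B * Y\<^sup>2" using assms X by (auto intro: mult_left_mono)
  then show "A + B \<le> A * X\<^sup>2 + B * Y\<^sup>2" by linarith
  assume "A * X\<^sup>2 + B * Y\<^sup>2 = A + B"
  then have "A * X\<^sup>2 = A * 1" "B * Y\<^sup>2 = B * 1" using * by linarith+
  then show "X\<^sup>2 = 1 \<and> Y\<^sup>2 = 1" using assms(1,2) by simp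
qed

text \<open>Each descent lowers \<open>z\<close> by 4. Exponent 1 contradicts
  \<open>A + B = C^2 > C\<close>, 3 is the cube case, and 4 would descend to norm 1 although
  \<open>A, B > 1\<close>; only 2 is left as a start, where \<open>\<eta>\<close> is
  \<open>\<epsilon>\<close> or its negative.\<close>

lemma weighted_squares_eq_power_imp_Complex_power:
  fixes A B C X Y :: int
  assumes sum: "A + B = C\<^sup>2" and C: "odd C" "C > 2" and gt: "A > 1" "B > 1"
    and cop: "coprime A C" "coprime B C"
    and XY: "coprime X C" "C dvd X - Y" "A * X\<^sup>2 + B * Y\<^sup>2 = C ^ z" and z: "z > 0"
  shows "\<exists>k. z = 4 * k + 2 \<and>
    (Complex (X * sqrt A) (Y * sqrt B) = Complex (sqrt A) (sqrt B) ^ (2 * k + 1) \<or>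
     Complex (X * sqrt A) (Y * sqrt B) = - (Complex (sqrt A) (sqrt B) ^ (2 * k + 1)))"
  using XY z
proof (induction z arbitrary: X Y rule: less_induct)
  case (less z)
  have nz: "X \<noteq> 0" "Y \<noteq> 0"
  proof -
    show "X \<noteq> 0" using less.prems(1) C by auto
    show "Y \<noteq> 0"
    proof
      assume "Y = 0"
      then have "C dvd X" using less.prems(2) by simp
      then have "is_unit C" using less.prems(1) by (meson coprime_common_divisor dvd_refl)
      then show False using C by simp
    qed
  qed
  consider "z = 1" | "z = 2" | "z = 3" | "z = 4" | "z > 4" using less.prems(4) by linarith
  then show ?case
  proof cases
    case 1
    have "C\<^sup>2 \<le> C" using weighted_squares_sum_bound(1)[of A B X Y] nz gt sum less.prems(3) 1 by simp
    then show ?thesis using C by (simp add: power2_eq_square)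
  next
    case 2
    have "X\<^sup>2 = 1 \<and> Y\<^sup>2 = 1"
      using weighted_squares_sum_bound(2)[of A B X Y] nz gt sum less.prems(3) 2 by simp
    then have X1: "X = 1 \<or> X = - 1" "Y = 1 \<or> Y = - 1" by (simp_all add: power2_eq_1_iff)
    \<comment> \<open>Opposite signs would make \<open>C > 2\<close> divide 2.\<close>
    have "X = Y"
    proof (rule ccontr)
      assume "X \<noteq> Y"
      then have "\<bar>C\<bar> \<le> \<bar>X - Y\<bar>" using less.prems(2) by (intro dvd_imp_le_int) auto
      then show False using X1 C by auto
    qed
    then show ?thesis using X1 2 by (intro exI[of _ 0]) (auto simp: complex_eq_iff)
  next
    case 3
    then show ?thesis using no_cube_representation[of A B C X Y] sum C gt cop less.prems by simp
  next
    case 4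
    obtain X1 Y1 where 1: "A * X1\<^sup>2 + B * Y1\<^sup>2 = C ^ (z - 4)"
      "X = X1 * (A - B) - 2 * B * Y1" "Y = Y1 * (A - B) + 2 * A * X1"
      using descent_step[OF sum C cop(2) less.prems(1-3)] 4 by auto
    have "A * X1\<^sup>2 + B * Y1\<^sup>2 = 1" using 1(1) 4 by simp
    moreover have "A * X1\<^sup>2 \<ge> 0" "B * Y1\<^sup>2 \<ge> 0" using gt by auto
    moreover have "A * X1\<^sup>2 = 0 \<or> A * X1\<^sup>2 \<ge> A"
      using gt mult_left_mono[of 1 "X1\<^sup>2" A] by (cases "X1 = 0") (auto simp: int_one_le_iff_zero_less)
    moreover have "B * Y1\<^sup>2 = 0 \<or> B * Y1\<^sup>2 \<ge> B"
      using gt mult_left_mono[of 1 "Y1\<^sup>2" B] by (cases "Y1 = 0") (auto simp: int_one_le_iff_zero_less)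
    ultimately show ?thesis using gt by linarith
  next
    case 5
    obtain X1 Y1 where 1: "A * X1\<^sup>2 + B * Y1\<^sup>2 = C ^ (z - 4)"
      "X = X1 * (A - B) - 2 * B * Y1" "Y = Y1 * (A - B) + 2 * A * X1"
      using descent_step[OF sum C cop(2) less.prems(1-3)] 5 by auto
    have "C dvd A * X1\<^sup>2 + B * Y1\<^sup>2" unfolding 1(1) using 5 by (simp add: dvd_power)
    then have c1: "coprime X1 C" "C dvd X1 - Y1"
      using descent_preserves_class[OF sum cop(1), of X1 Y1] less.prems(1) 1(2) by auto
    define \<epsilon> where "\<epsilon> = Complex (sqrt A) (sqrt B)"
    define \<eta> where "\<eta> = Complex (X1 * sqrt A) (Y1 * sqrt B)"
    obtain k where k: "z - 4 = 4 * k + 2" "\<eta> = \<epsilon> ^ (2 * k + 1) \<or> \<eta> = - (\<epsilon> ^ (2 * k + 1))"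
      using less.IH[OF _ c1 1(1)] 5 unfolding \<epsilon>_def \<eta>_def by auto
    define a b where "a = sqrt A" and "b = sqrt B"
    have AB: "real_of_int A = a * a" "real_of_int B = b * b" using gt by (auto simp: a_def b_def)
    have "Complex (X * sqrt A) (Y * sqrt B) = \<epsilon>\<^sup>2 * \<eta>"
      unfolding \<epsilon>_def \<eta>_def a_def[symmetric] b_def[symmetric] 1(2,3)
      by (simp add: complex_eq_iff power2_eq_square AB algebra_simps)
    then have "Complex (X * sqrt A) (Y * sqrt B) = \<epsilon> ^ (2 * (k + 1) + 1) \<or>
        Complex (X * sqrt A) (Y * sqrt B) = - (\<epsilon> ^ (2 * (k + 1) + 1))"
      using k(2) by (auto simp: power2_eq_square)
    moreover have "z = 4 * (k + 1) + 2" using k(1) 5 by simp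
    ultimately show ?thesis unfolding \<epsilon>_def by blast
  qed
qed

lemma weighted_squares_eq_power_imp_odd_binom_sum:
  fixes A B C X Y :: int
  assumes "A + B = C\<^sup>2" "odd C" "C > 2" and gt: "A > 1" "B > 1"
    and "coprime A C" "coprime B C" "coprime X C" "C dvd X - Y" "A * X\<^sup>2 + B * Y\<^sup>2 = C ^ z" "z > 0"
  obtains k where "z = 4 * k + 2" "\<bar>odd_binom_sum A (- B) k\<bar> = \<bar>X\<bar>" "\<bar>odd_binom_sum (- B) A k\<bar> = \<bar>Y\<bar>"
proof -
  obtain k where k: "z = 4 * k + 2"
    "Complex (X * sqrt A) (Y * sqrt B) = Complex (sqrt A) (sqrt B) ^ (2 * k + 1) \<or>
     Complex (X * sqrt A) (Y * sqrt B) = - (Complex (sqrt A) (sqrt B) ^ (2 * k + 1))"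
    using weighted_squares_eq_power_imp_Complex_power[OF assms] by blast
  define P Q where "P = odd_binom_sum A (- B) k" and "Q = odd_binom_sum (- B) A k"
  have A0: "A \<ge> 0" and B0: "B \<ge> 0" using gt by simp_all
  have "X * sqrt A = P * sqrt A \<and> Y * sqrt B = Q * sqrt B \<or>
      X * sqrt A = of_int (- P) * sqrt A \<and> Y * sqrt B = of_int (- Q) * sqrt B"
    using k(2) gt unfolding Complex_sqrt_power_odd[of A B k, folded P_def Q_def, OF A0 B0]
    by (simp add: complex_eq_iff mult.commute)
  then have "X = P \<and> Y = Q \<or> X = - P \<and> Y = - Q"
    using gt unfolding mult_cancel_right of_int_eq_iff by simp
  then show ?thesis using that[OF k(1)] unfolding P_def Q_def by auto
qed

section \<open>The exponential equation\<close>

theorem mainTheorem1: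
  fixes l m r A B C :: int
  assumes "l > 0" and "m > 0" and "r > 0"
    and "\<not> 2 dvd l" and "\<not> 3 dvd l * m" and "l > r" and "3 dvd r"
    and "A = r * l * m ^ 2 - 1"
    and "B = (l - r) * l * m ^ 2 + 1"
    and "C = l * m"
    and "min (r * l * m ^ 2 - 1) ((l - r) * l * m ^ 2 + 1) > 30"
  shows "{(x :: nat, y :: nat, z :: nat). x > 0 \<and> y > 0 \<and> z > 0 \<and> A ^ x + B ^ y = C ^ z}
           = {(1, 1, 2)}"
proof -
  have gt: "A > 1" "B > 1" using assms(8,9,11) by auto
  have sum: "A + B = C\<^sup>2" unfolding assms(8-10) by algebra
  have C5: "C \<ge> 5"
  proof -
    have "r \<ge> 3" using assms(3,7) zdvd_imp_le by blast
    then have "l \<ge> 5" using assms(4,6) by presburger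
    moreover have "l * 1 \<le> l * m" using assms(1,2) by (intro mult_left_mono) auto
    ultimately show ?thesis unfolding assms(10) by linarith
  qed
  \<comment> \<open>Working with \<open>-A\<close> makes both bases 1 modulo
    \<open>C\<close>.\<close>
  have A_C: "- A - 1 = C * (- r * m)" and B_C: "B - 1 = C * ((l - r) * m)"
    unfolding assms(8-10) by (simp_all add: power2_eq_square algebra_simps)
  have negA: "C dvd (- A) ^ n - 1" and powB: "C dvd B ^ n - 1" for n
    by (rule dvd_power_minus_one, simp add: A_C B_C)+
  have n3C: "\<not> 3 dvd C" using assms(5,10) by simp
  have A3: "3 dvd - A - 1" using assms(7) by (simp add: A_C)
  \<comment> \<open>\<open>C^2\<close> is 1 and \<open>A\<close> is -1 modulo 3, so
    \<open>B = C^2 - A\<close> is 2, that is -1.\<close>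
  have B3: "3 dvd - B - 1"
  proof -
    have "C mod 3 = 1 \<or> C mod 3 = 2" using n3C by presburger
    then have "C\<^sup>2 mod 3 = 1" by (auto simp: power_mod[symmetric, of C])
    then have "3 dvd 1 - C\<^sup>2" by (simp add: mod_eq_dvd_iff[symmetric])
    moreover have "- B - 1 = (A + 1) + (1 - C\<^sup>2) - 3" unfolding sum[symmetric] by simp
    ultimately show ?thesis using A3 by presburger
  qed
  have n3: "\<not> 3 dvd A" "\<not> 3 dvd B" using A3 B3 by presburger+
  have cop: "coprime A C" "coprime B C"
  proof -
    have "- 1 - A = C * (- r * m)" "1 - B = C * (- ((l - r) * m))" using A_C B_C by simp_all
    then have "C dvd - 1 - A" "C dvd 1 - B" by (metis dvd_triv_left)+
    then show "coprime A C" "coprime B C"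
      using coprime_of_dvd_diff[of "- 1" C A] coprime_of_dvd_diff[of 1 C B] by simp_all
  qed
  have copAB: "coprime A B"
  proof (rule coprimeI)
    fix d assume d: "d dvd A" "d dvd B"
    then have "d dvd C\<^sup>2" unfolding sum[symmetric] by simp
    moreover have "coprime A (C\<^sup>2)" using cop(1) by simp
    ultimately show "is_unit d" using d(1) by (meson coprime_common_divisor)
  qed
  have "(x, y, z) = (1, 1, 2)"
    if x: "x > 0" and y: "y > 0" and z: "z > 0" and eq: "A ^ x + B ^ y = C ^ z" for x y z :: nat
  proof -
    \<comment> \<open>For even \<open>x\<close> the left side would be 2 modulo \<open>C\<close>,
      but \<open>C \<ge> 5\<close>.\<close>
    have "odd x"
    proof
      assume "even x"
      then have "A ^ x = (- A) ^ x" by simp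
      then have "2 = C ^ z - ((- A) ^ x - 1) - (B ^ y - 1)" using eq by simp
      also have "C dvd \<dots>" using z by (intro dvd_diff negA powB) (simp add: dvd_power)
      finally show False using C5 zdvd_imp_le[of C 2] by simp
    qed
    \<comment> \<open>For even \<open>y\<close> the left side would be \<open>-1 + 1 = 0\<close>
      modulo 3.\<close>
    have "odd y"
    proof
      assume "even y"
      then have "B ^ y = (- B) ^ y" by simp
      moreover have "A ^ x = - ((- A) ^ x)" using \<open>odd x\<close> by simp
      ultimately have "C ^ z = ((- B) ^ y - 1) - ((- A) ^ x - 1)" using eq by simp
      also have "3 dvd \<dots>" by (intro dvd_diff dvd_power_minus_one A3 B3)
      finally have "3 dvd C" by (rule prime_dvd_power[rotated]) simp
      then show False using n3C by simp
    qed
    have le: "A ^ 1 \<le> A ^ x" "B ^ 1 \<le> B ^ y" 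
      using gt x y power_increasing[of 1 x A] power_increasing[of 1 y B] by simp_all
    then have "C\<^sup>2 \<le> C ^ z" using eq sum by simp
    then have "z \<ge> 2" using C5 by simp
    have "z = 2"
    proof (rule ccontr)
      assume "z \<noteq> 2"
      then have z3: "z \<ge> 3" using \<open>z \<ge> 2\<close> by simp
      \<comment> \<open>Modulo \<open>m^3\<close>, the power that \<open>C^z\<close> supplies for
        \<open>z \<ge> 3\<close>, only the linear terms in \<open>u\<close>, \<open>v\<close>
        survive, so \<open>m\<close> divides \<open>l (y (l - r) + x r)\<close>. For odd
        \<open>x\<close>, \<open>y\<close> the bracket has the parity of \<open>l\<close>, so the
        product is odd.\<close>
      have "odd m"
      proof
        assume m: "even m"
        define u v where "u = - (r * l * m\<^sup>2)" and "v = (l - r) * l * m\<^sup>2"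
        have uv: "- A = 1 + u" "B = 1 + v" unfolding assms(8,9) u_def v_def by simp_all
        have "m ^ 3 dvd u\<^sup>2" "m ^ 3 dvd v\<^sup>2"
          unfolding u_def v_def by (simp_all add: power_mult_distrib le_imp_power_dvd flip: power_mult)
        then have 1: "m ^ 3 dvd (- A) ^ x - (1 + of_nat x * u)" "m ^ 3 dvd B ^ y - (1 + of_nat y * v)"
          unfolding uv using square_dvd_power_minus_linear dvd_trans by blast+
        have 2: "m ^ 3 dvd C ^ z"
          unfolding assms(10) power_mult_distrib using z3 by (intro dvd_mult le_imp_power_dvd)
        have "C ^ z = B ^ y - (- A) ^ x" using eq \<open>odd x\<close> by simp
        then have "int y * v - int x * u = C ^ z + ((- A) ^ x - (1 + of_nat x * u)) - (B ^ y - (1 + of_nat y * v))"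
          by simp
        also have "m ^ 3 dvd \<dots>" by (intro dvd_add dvd_diff 1 2)
        also have "int y * v - int x * u = m\<^sup>2 * (l * (int y * (l - r) + int x * r))"
          unfolding u_def v_def by algebra
        finally have "m\<^sup>2 * m dvd m\<^sup>2 * (l * (int y * (l - r) + int x * r))"
          by (simp add: power2_eq_square power3_eq_cube mult.assoc)
        then have "m dvd l * (int y * (l - r) + int x * r)" using assms(2) by simp
        then have "even (l * (int y * (l - r) + int x * r))" using m by (rule dvd_trans[rotated])
        then show False using assms(4) \<open>odd x\<close> \<open>odd y\<close> by simp
      qed
      then have oddC: "odd C" using assms(4) by (simp add: assms(10))
      obtain a b where ab: "x = 2 * a + 1" "y = 2 * b + 1"
        using \<open>odd x\<close> \<open>odd y\<close> by (meson oddE)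
      \<comment> \<open>The sign in \<open>X = (-A)^a\<close> makes \<open>X\<close> and
        \<open>Y = B^b\<close> both 1 modulo \<open>C\<close>.\<close>
      have XY: "A * ((- A) ^ a)\<^sup>2 + B * (B ^ b)\<^sup>2 = C ^ z"
        unfolding eq[symmetric] ab by (simp add: mult.commute flip: power_mult)
      have "C dvd ((- A) ^ a - 1) - (B ^ b - 1)" by (intro dvd_diff negA powB)
      then have "C dvd (- A) ^ a - B ^ b" by simp
      moreover have "coprime ((- A) ^ a) C" using cop by simp
      ultimately obtain k where k: "z = 4 * k + 2"
        "\<bar>odd_binom_sum A (- B) k\<bar> = \<bar>(- A) ^ a\<bar>" "\<bar>odd_binom_sum (- B) A k\<bar> = \<bar>B ^ b\<bar>"
        using weighted_squares_eq_power_imp_odd_binom_sum[OF sum oddC _ gt cop _ _ XY z] C5 by auto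
      have "\<bar>A\<bar> ^ a \<le> int (2 * k + 1)"
        using k(2) gt copAB n3 by (intro power_eq_odd_binom_sum_imp_le[of A "- B" k A a]) (auto simp: power_abs)
      then have Aa: "((- A) ^ a)\<^sup>2 \<le> (int (2 * k + 1))\<^sup>2"
        by (intro abs_le_square_iff[THEN iffD1]) (simp add: power_abs)
      have "\<bar>B\<bar> ^ b \<le> int (2 * k + 1)"
        using k(3) gt copAB n3 by (intro power_eq_odd_binom_sum_imp_le[of "- B" A k B b])
          (auto simp: power_abs coprime_commute)
      then have Bb: "(B ^ b)\<^sup>2 \<le> (int (2 * k + 1))\<^sup>2"
        by (intro abs_le_square_iff[THEN iffD1]) (simp add: power_abs)
      \<comment> \<open>Both squares are at most \<open>(2k+1)^2\<close>; cancelling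
        \<open>A + B = C^2\<close> leaves \<open>C^(2k) \<le> 2k+1\<close>, impossible because
        \<open>z \<ge> 3\<close> gives \<open>k > 0\<close>.\<close>
      have "C\<^sup>2 * (C ^ (2 * k))\<^sup>2 = C ^ z" unfolding k(1) by (simp add: mult.commute flip: power_mult power_add)
      also have "\<dots> \<le> A * (int (2 * k + 1))\<^sup>2 + B * (int (2 * k + 1))\<^sup>2"
        unfolding XY[symmetric] using Aa Bb gt by (intro add_mono mult_left_mono) auto
      also have "\<dots> = C\<^sup>2 * (int (2 * k + 1))\<^sup>2" unfolding sum[symmetric] by algebra
      finally have "(C ^ (2 * k))\<^sup>2 \<le> (int (2 * k + 1))\<^sup>2" using C5 by simp
      then have "C ^ (2 * k) \<le> int (2 * k + 1)" by (rule power2_le_imp_le) simp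
      moreover have "5 ^ (2 * k) \<le> C ^ (2 * k)" using C5 by (intro power_mono) auto
      moreover have "k > 0" using z3 k(1) by simp
      then have "(5::int) ^ (2 * k) > int (2 * k + 1)"
        by (induction k rule: nat_induct_non_zero) auto
      ultimately show False by simp
    qed
    \<comment> \<open>Now \<open>A^x + B^y = A + B\<close>, so both inequalities in
      \<open>le\<close> are equalities.\<close>
    then have "A ^ x = A ^ 1 \<and> B ^ y = B ^ 1" using eq sum le by simp
    then have "x = 1 \<and> y = 1" using gt power_inject_exp by blast
    then show ?thesis using \<open>z = 2\<close> by simp
  qed
  then show ?thesis using sum by auto
qed

end
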